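(* For every non-negative integer $n$ and every integer $s$, \[ \sum_{k = 0}^{\lfloor n/2 \rfloor } \binom {n}{2k} F_{6k + s}= 2^{n-1} \big(F_{2n+s} + (-1)^n F_{n+s}\big),\qquad \sum_{k = 0}^{\lfloor n/2 \rfloor } \binom {n}{2k} L_{6k + s}= 2^{n-1} \big(L_{2n+s} + (-1)^n L_{n+s}\big). \]
   Context: The Fibonacci numbers $F_j$ and Lucas numbers $L_j$ are defined for all integers $j$ by $F_0=0$, $F_1=1$, $L_0=2$, $L_1=1$, $F_j=F_{j-1}+F_{j-2}$, $L_j=L_{j-1}+L_{j-2}$, with $F_{-j}=(-1)^{j-1}F_j$ and $L_{-j}=(-1)^jL_j$. *)

theory Defs
  imports "HOL-Number_Theory.Fib"
begin

fun lucas :: "nat \<Rightarrow> nat"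
  where
    "lucas 0 = 2"
  | "lucas (Suc 0) = 1"
  | "lucas (Suc (Suc n)) = lucas (Suc n) + lucas n"

definition fib_int :: "int \<Rightarrow> int"
  where "fib_int j =
    (if j \<ge> 0 then int (fib (nat j)) else (- 1) ^ (nat (- j) - 1) * int (fib (nat (- j))))"

definition lucas_int :: "int \<Rightarrow> int"
  where "lucas_int j =
    (if j \<ge> 0 then int (lucas (nat j)) else (- 1) ^ nat (- j) * int (lucas (nat (- j))))"

lemma fib_int_of_nat [simp]: "fib_int (int n) = int (fib n)"
  by (simp add: fib_int_def)

lemma lucas_int_of_nat [simp]: "lucas_int (int n) = int (lucas n)"
  by (simp add: lucas_int_def)

lemma fib_int_neg: "fib_int (- int n) = (- 1) ^ (n + 1) * int (fib n)"
  by (cases n) (auto simp: fib_int_def nat_add_distrib)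

lemma lucas_int_neg: "lucas_int (- int n) = (- 1) ^ n * int (lucas n)"
  by (cases n) (auto simp: lucas_int_def nat_add_distrib)

lemma int_cases_recurrence:
  fixes j :: int
  obtains n where "j = int n + 2" | "j = 1" | n where "j = - int n"
proof -
  consider "j \<ge> 2" | "j = 1" | "j \<le> 0" by linarith
  then show thesis
  proof cases
    case 1
    then have "j = int (nat (j - 2)) + 2" by simp
    then show thesis by (rule that(1))
  next
    case 2
    then show thesis by (rule that(2))
  next
    case 3
    then have "j = - int (nat (- j))" by simp
    then show thesis by (rule that(3))
  qed
qed

lemma fib_int_rec: "fib_int j = fib_int (j - 1) + fib_int (j - 2)"
proof (cases j rule: int_cases_recurrence)
  case (1 n)
  then have "j = int (Suc (Suc n))" "j - 1 = int (Suc n)" "j - 2 = int n" by simp_all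
  then show ?thesis by (simp only: fib_int_of_nat) simp
next
  case 2
  then show ?thesis by (simp add: fib_int_def)
next
  case (3 n)
  then have "j - 1 = - int (Suc n)" "j - 2 = - int (Suc (Suc n))" by simp_all
  then show ?thesis using 3 by (simp only: fib_int_neg) (simp add: algebra_simps)
qed

lemma lucas_int_rec: "lucas_int j = lucas_int (j - 1) + lucas_int (j - 2)"
proof (cases j rule: int_cases_recurrence)
  case (1 n)
  then have "j = int (Suc (Suc n))" "j - 1 = int (Suc n)" "j - 2 = int n" by simp_all
  then show ?thesis by (simp only: lucas_int_of_nat) simp
next
  case 2
  then show ?thesis by (simp add: lucas_int_def)
next
  case (3 n)
  then have "j - 1 = - int (Suc n)" "j - 2 = - int (Suc (Suc n))" by simp_all
  then show ?thesis using 3 by (simp only: lucas_int_neg) (simp add: algebra_simps)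
qed

end

theory Submission
  imports Defs
begin

text \<open>
  Let \<open>E\<close> be the shift operator on sequences satisfying the Fibonacci recurrence, so \<open>E\<^sup>2 = E + 1\<close>.
  Then \<open>1 + E\<^sup>3 = 2 E\<^sup>2\<close> and \<open>1 - E\<^sup>3 = - 2 E\<close>. Raising both identities to the \<open>n\<close>-th power,
  expanding the left-hand sides binomially and adding the results cancels the terms of odd index.
\<close>

text \<open>Pascal's rule splits each coefficient in two. After an index shift, the part that keeps
  \<open>f k\<close> gains only a top term \<open>n choose Suc n\<close>, which is zero. This drives
  the induction in \<open>binomial_shift_sum\<close>.\<close>

lemma sum_choose_Suc:
  fixes f :: "nat \<Rightarrow> 'a::comm_semiring_1"
  shows "(\<Sum>k\<le>Suc n. of_nat (Suc n choose k) * f k) = (\<Sum>k\<le>n. of_nat (n choose k) * (f k + f (Suc k)))"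
proof -
  have "(\<Sum>k\<le>Suc n. of_nat (Suc n choose k) * f k)
      = f 0 + (\<Sum>k\<le>n. of_nat (n choose Suc k) * f (Suc k)) + (\<Sum>k\<le>n. of_nat (n choose k) * f (Suc k))"
    by (subst sum.atMost_Suc_shift) (simp add: sum.distrib algebra_simps)
  also have "f 0 + (\<Sum>k\<le>n. of_nat (n choose Suc k) * f (Suc k)) = (\<Sum>k\<le>Suc n. of_nat (n choose k) * f k)"
    by (subst sum.atMost_Suc_shift) simp
  also have "\<dots> = (\<Sum>k\<le>n. of_nat (n choose k) * f k)"
    by (simp add: binomial_eq_0)
  finally show ?thesis
    by (simp add: sum.distrib distrib_left)
qed

text \<open>The assumption is the operator identity \<open>1 + c E^p = d E^m\<close> on
  \<open>G\<close>; the conclusion is its \<open>n\<close>-th power, expanded binomially and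
  evaluated at \<open>s\<close>.\<close>

lemma binomial_shift_sum:
  fixes G :: "int \<Rightarrow> 'a::comm_semiring_1"
  assumes "\<And>j. G j + c * G (j + p) = d * G (j + m)"
  shows "(\<Sum>k\<le>n. of_nat (n choose k) * (c ^ k * G (p * int k + s))) = d ^ n * G (m * int n + s)"
\<comment> \<open>Trading one factor \<open>1 + c E^p\<close> for \<open>d E^m\<close> moves the
  base point from \<open>s\<close> to \<open>m + s\<close>, so \<open>s\<close> must vary.\<close>
proof (induction n arbitrary: s)
  case 0
  show ?case by simp
next
  case (Suc n)
  have step: "c ^ k * G (p * int k + s) + c ^ Suc k * G (p * int (Suc k) + s)
      = d * (c ^ k * G (p * int k + (m + s)))" for k
  proof -
    have "c ^ k * G (p * int k + s) + c ^ Suc k * G (p * int (Suc k) + s)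
        = c ^ k * (G (p * int k + s) + c * G ((p * int k + s) + p))"
      by (simp add: algebra_simps)
    also have "\<dots> = c ^ k * (d * G ((p * int k + s) + m))"
      by (simp only: assms)
    finally show ?thesis
      by (simp add: ac_simps)
  qed
  have "(\<Sum>k\<le>Suc n. of_nat (Suc n choose k) * (c ^ k * G (p * int k + s)))
      = (\<Sum>k\<le>n. of_nat (n choose k) * (d * (c ^ k * G (p * int k + (m + s)))))"
    by (simp only: sum_choose_Suc step)
  also have "\<dots> = d * (\<Sum>k\<le>n. of_nat (n choose k) * (c ^ k * G (p * int k + (m + s))))"
    by (simp add: sum_distrib_left ac_simps)
  also have "\<dots> = d ^ Suc n * G (m * int (Suc n) + s)"
    by (subst Suc) (simp add: algebra_simps)
  finally show ?case .
qed

text \<open>The factor \<open>1 + (-1)^k\<close> is 2 for even \<open>k\<close> and 0 for odd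
  \<open>k\<close>. The 2 stays on the right because a commutative ring need not allow
  halving.\<close>

lemma sum_even_indices:
  fixes g :: "nat \<Rightarrow> 'a::comm_ring_1"
  shows "(\<Sum>k\<le>n. g k + (- 1) ^ k * g k) = 2 * (\<Sum>k = 0..n div 2. g (2 * k))"
proof -
  have "(\<Sum>k\<le>n. g k + (- 1) ^ k * g k) = (\<Sum>k | k \<le> n \<and> even k. 2 * g k)"
    by (rule sum.mono_neutral_cong_right) auto
  also have "\<dots> = (\<Sum>k = 0..n div 2. 2 * g (2 * k))"
    by (rule sum.reindex_bij_witness[of _ "\<lambda>k. 2 * k" "\<lambda>k. k div 2"]) auto
  finally show ?thesis
    by (simp add: sum_distrib_left)
qed

text \<open>The argument uses the recurrence alone and no initial values, so it serves Fibonacci and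
  Lucas numbers alike.\<close>

lemma sum_even_choose_fib_recurrence:
  fixes G :: "int \<Rightarrow> real"
  assumes rec: "\<And>j. G j = G (j - 1) + G (j - 2)"
  shows "(\<Sum>k = 0..n div 2. real (n choose (2 * k)) * G (6 * int k + s))
       = 2 powi (int n - 1) * (G (2 * int n + s) + (- 1) ^ n * G (int n + s))"
proof -
  have rec2: "G (j + 2) = G (j + 1) + G j" and rec3: "G (j + 3) = G (j + 2) + G (j + 1)" for j
    using rec[of "j + 2"] rec[of "j + 3"] by (simp_all add: add.commute)
  \<comment> \<open>Here \<open>c = 1\<close>, \<open>p = 3\<close>, \<open>d = 2\<close>,
    \<open>m = 2\<close>; the idle power \<open>1 ^ k\<close> keeps the shape of
    \<open>binomial_shift_sum\<close>.\<close>
  have plus: "(\<Sum>k\<le>n. real (n choose k) * (1 ^ k * G (3 * int k + s))) = 2 ^ n * G (2 * int n + s)"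
    by (rule binomial_shift_sum) (simp add: rec2 rec3)
  \<comment> \<open>Here \<open>c = -1\<close>, \<open>p = 3\<close>, \<open>d = -2\<close>,
    \<open>m = 1\<close>, from \<open>G j - G (j + 3) = -2 * G (j + 1)\<close>.\<close>
  have minus: "(\<Sum>k\<le>n. real (n choose k) * ((- 1) ^ k * G (3 * int k + s))) = (- 2) ^ n * G (1 * int n + s)"
    by (rule binomial_shift_sum) (simp add: rec2 rec3)
  have "2 * (\<Sum>k = 0..n div 2. real (n choose (2 * k)) * G (6 * int k + s))
      = (\<Sum>k\<le>n. real (n choose k) * G (3 * int k + s) + (- 1) ^ k * (real (n choose k) * G (3 * int k + s)))"
    by (subst sum_even_indices) simp
  also have "\<dots> = 2 ^ n * G (2 * int n + s) + (- 2) ^ n * G (int n + s)"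
    using plus minus by (simp add: sum.distrib ac_simps)
  also have "\<dots> = 2 ^ n * (G (2 * int n + s) + (- 1) ^ n * G (int n + s))"
    by (simp add: power_minus[of 2] algebra_simps)
  \<comment> \<open>Halving turns \<open>2 ^ n\<close> into \<open>2 powi (int n - 1)\<close>, which
    is 1/2 when \<open>n = 0\<close>.\<close>
  finally show ?thesis
    by (simp add: power_int_diff)
qed

theorem theorem5:
  fixes n :: nat and s :: int
  shows "(\<Sum>k = 0..n div 2. real (n choose (2 * k)) * real_of_int (fib_int (6 * int k + s)))
           = 2 powi (int n - 1)
             * (real_of_int (fib_int (2 * int n + s)) + (- 1) ^ n * real_of_int (fib_int (int n + s)))
       \<and> (\<Sum>k = 0..n div 2. real (n choose (2 * k)) * real_of_int (lucas_int (6 * int k + s)))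
           = 2 powi (int n - 1)
             * (real_of_int (lucas_int (2 * int n + s)) + (- 1) ^ n * real_of_int (lucas_int (int n + s)))"
proof
  have "real_of_int (fib_int j) = real_of_int (fib_int (j - 1)) + real_of_int (fib_int (j - 2))" for j
    by (subst fib_int_rec) simp
  then show "(\<Sum>k = 0..n div 2. real (n choose (2 * k)) * real_of_int (fib_int (6 * int k + s)))
           = 2 powi (int n - 1)
             * (real_of_int (fib_int (2 * int n + s)) + (- 1) ^ n * real_of_int (fib_int (int n + s)))"
    by (rule sum_even_choose_fib_recurrence)
  have "real_of_int (lucas_int j) = real_of_int (lucas_int (j - 1)) + real_of_int (lucas_int (j - 2))" for j
    by (subst lucas_int_rec) simp
  then show "(\<Sum>k = 0..n div 2. real (n choose (2 * k)) * real_of_int (lucas_int (6 * int k + s)))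
           = 2 powi (int n - 1)
             * (real_of_int (lucas_int (2 * int n + s)) + (- 1) ^ n * real_of_int (lucas_int (int n + s)))"
    by (rule sum_even_choose_fib_recurrence)
qed

end
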